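(* Let $G$ be a finite abelian group. For every sequence $(g_k)_{k=1}^{|G|}$ of $|G|$ elements of $G$ there is a nonempty subsequence $(g_k)_{k\in K}$ (with $\emptyset\neq K\subseteq\{1,\dots,|G|\}$) such that $\sum_{k\in K}g_k=0_G$ and $\sum_{k\in K}1/|g_k|\le 1$.
   Context: Here $|G|$ denotes the order of $G$, $0_G$ its identity element, and $|g|$ denotes the order of an element $g\in G$. Sequences may contain repeated elements. *)

theory Defs
  imports "HOL-Algebra.Algebra"
begin

end

theory Submission
  imports Defs
begin

text \<open>
The statement is proved for all pairs of subgroups \<open>N \<subseteq> M\<close>, with orders taken modulo \<open>N\<close>, by
induction on the index \<open>n = |M : N|\<close>, together with a pebbling-style companion in the spirit of
Chung's two-pebbling property: a sequence in \<open>M\<close> of length \<open>s\<close> realising \<open>c\<close> distinct orders with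
\<open>s + c > 2n\<close> has two disjoint blocks.

Let \<open>e\<close> be the exponent of \<open>M/N\<close>, \<open>p\<close> a prime divisor of \<open>e\<close>, \<open>q = e/p\<close>, and \<open>L\<close> the subgroup of
the \<open>x \<in> M\<close> with \<open>x\<^sup>q \<in> N\<close>, of index \<open>f\<close> over \<open>N\<close>. For \<open>x \<in> M - L\<close> the sets \<open>L\<langle>x\<rangle> - L\<close>
partition \<open>M - L\<close>, and \<open>L\<langle>x\<rangle>\<close> has index \<open>f\<close> over \<open>N\<langle>x\<^sup>q\<rangle>\<close>. There are two ways to
use the terms outside \<open>L\<close>. Among \<open>p\<close> terms of one class \<open>L\<langle>x\<rangle> - L\<close> of equal order \<open>d\<close>
some have a product in \<open>L\<close>, of order at most \<open>d/p\<close>, so they can be replaced by that product. Or,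
if a class has \<open>s + c > pf\<close>, the induction hypothesis for \<open>L\<langle>x\<rangle>\<close> over \<open>N\<langle>x\<^sup>q\<rangle>\<close> gives \<open>p\<close>
disjoint blocks with product in \<open>N\<langle>x\<^sup>q\<rangle>\<close> and weight at most \<open>1/p\<close>, some of which multiply into
\<open>N\<close>. If the second way fails for every class, counting shows that the first one produces \<open>f\<close>
terms in \<open>L\<close>.
\<close>

section \<open>Periods, colour classes and divisor counts\<close>

text \<open>Shifts by the least period reduce \<open>j\<close> to \<open>j mod d\<close>, and
  minimality leaves only remainder 0. With \<open>P j\<close> saying that all \<open>j\<close>-th
  powers lie in a subgroup, orders and exponents become divisibility statements.\<close>

lemma dvd_iff_least_period:
  fixes P :: "nat \<Rightarrow> bool"
  assumes "P k" "0 < k" and step: "\<And>a b. P a \<Longrightarrow> P (a + b) \<longleftrightarrow> P b"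
  shows "P j \<longleftrightarrow> (LEAST k. 0 < k \<and> P k) dvd j" and "0 < (LEAST k. 0 < k \<and> P k)"
proof -
  define d where "d = (LEAST k. 0 < k \<and> P k)"
  have d: "0 < d \<and> P d"
    using LeastI[of "\<lambda>k. 0 < k \<and> P k" k] assms(1,2) by (simp add: d_def)
  have P0: "P 0" using step[of k 0] assms(1) by simp
  have mult: "P (d * a + b) \<longleftrightarrow> P b" for a b
  proof (induction a)
    case (Suc a)
    then show ?case using step[of d "d * a + b"] d by (simp add: add.assoc)
  qed simp
  have "P j \<longleftrightarrow> P (j mod d)" using mult[of "j div d" "j mod d"] by simp
  also have "\<dots> \<longleftrightarrow> j mod d = 0"
  proof
    assume "P (j mod d)"
    moreover have "j mod d < d" using d by simp
    ultimately show "j mod d = 0"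
      using not_less_Least[of "j mod d" "\<lambda>k. 0 < k \<and> P k"] by (metis d_def neq0_conv)
  qed (use P0 in simp)
  also have "\<dots> \<longleftrightarrow> d dvd j" by auto
  finally show "P j \<longleftrightarrow> (LEAST k. 0 < k \<and> P k) dvd j" by (simp add: d_def)
  show "0 < (LEAST k. 0 < k \<and> P k)" using d by (simp add: d_def)
qed

text \<open>Monochromatic \<open>p\<close>-sets are removed greedily until every colour has at most
  \<open>p - 1\<close> elements left; these leftovers give the last summand.\<close>

lemma disjoint_monochromatic_subsets:
  fixes \<kappa> :: "'i \<Rightarrow> 'c"
  assumes "finite J" "0 < p"
  shows "\<exists>\<F>. finite \<F> \<and> pairwise disjnt \<F> \<and>
           (\<forall>F\<in>\<F>. F \<subseteq> J \<and> card F = p \<and> (\<exists>c. \<forall>i\<in>F. \<kappa> i = c)) \<and>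
           card J \<le> p * card \<F> + (p - 1) * card (\<kappa> ` J)"
  using assms(1)
proof (induction "card J" arbitrary: J rule: less_induct)
  case less
  show ?case
  proof (cases "\<exists>c. p \<le> card {i \<in> J. \<kappa> i = c}")
    case True
    then obtain c where "p \<le> card {i \<in> J. \<kappa> i = c}" by blast
    then obtain F where F: "F \<subseteq> {i \<in> J. \<kappa> i = c}" "card F = p" "finite F"
      by (rule obtain_subset_with_card_n)
    have FJ: "F \<subseteq> J" using F by auto
    have card: "card (J - F) = card J - p" "p \<le> card J"
      using F FJ less.prems by (auto simp: card_Diff_subset intro: card_mono)
    obtain \<F> where \<F>: "finite \<F>" "pairwise disjnt \<F>"
        "\<And>E. E \<in> \<F> \<Longrightarrow> E \<subseteq> J - F \<and> card E = p \<and> (\<exists>c. \<forall>i\<in>E. \<kappa> i = c)"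
        "card (J - F) \<le> p * card \<F> + (p - 1) * card (\<kappa> ` (J - F))"
      using less.hyps[of "J - F"] card less.prems assms(2) by auto
    have F_notin: "F \<notin> \<F>" using \<F>(3)[of F] F(2) assms(2) by (metis Diff_disjoint card.empty inf.absorb_iff1 inf_commute less_irrefl)
    have "card (\<kappa> ` (J - F)) \<le> card (\<kappa> ` J)"
      using less.prems by (intro card_mono) auto
    then have "(p - 1) * card (\<kappa> ` (J - F)) \<le> (p - 1) * card (\<kappa> ` J)" by simp
    moreover have "p * card (insert F \<F>) = p + p * card \<F>" using \<F>(1) F_notin by simp
    ultimately have le: "card J \<le> p * card (insert F \<F>) + (p - 1) * card (\<kappa> ` J)"
      using \<F>(4) card by linarith
    have disj: "pairwise disjnt (insert F \<F>)"
      using \<F>(2,3) unfolding pairwise_insert disjnt_def by blast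
    have props: "\<forall>E\<in>insert F \<F>. E \<subseteq> J \<and> card E = p \<and> (\<exists>c. \<forall>i\<in>E. \<kappa> i = c)"
      using \<F>(3) F FJ by blast
    show ?thesis
      using le disj props \<F>(1) by (intro exI[of _ "insert F \<F>"]) simp
  next
    case False
    have "card J = (\<Sum>c\<in>\<kappa> ` J. card {i \<in> J. \<kappa> i = c})"
      using sum.image_gen[OF less.prems, of "\<lambda>_. 1::nat" \<kappa>] by simp
    also have "\<dots> \<le> (\<Sum>c\<in>\<kappa> ` J. p - 1)"
    proof (rule sum_mono)
      fix c
      have "\<not> p \<le> card {i \<in> J. \<kappa> i = c}" using False by blast
      then show "card {i \<in> J. \<kappa> i = c} \<le> p - 1" by simp
    qed
    also have "\<dots> = (p - 1) * card (\<kappa> ` J)" by simp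
    finally show ?thesis by (intro exI[of _ "{}"]) simp
  qed
qed

text \<open>One representative of each colour is set aside before grouping, at the cost of one more
  leftover per colour. When colours are orders, the groups can be removed without lowering the
  number of distinct orders.\<close>

lemma disjoint_monochromatic_subsets_keeping_colors:
  fixes \<kappa> :: "'i \<Rightarrow> 'c"
  assumes "finite J" "0 < p"
  shows "\<exists>\<F>. finite \<F> \<and> pairwise disjnt \<F> \<and>
           (\<forall>F\<in>\<F>. F \<subseteq> J \<and> card F = p \<and> (\<exists>c. \<forall>i\<in>F. \<kappa> i = c)) \<and>
           card J \<le> p * card \<F> + p * card (\<kappa> ` J) \<and> \<kappa> ` (J - \<Union>\<F>) = \<kappa> ` J"
proof -
  obtain R where R: "R \<subseteq> J" "inj_on \<kappa> R" "\<kappa> ` J = \<kappa> ` R"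
    by (metis subset_image_inj[of "\<kappa> ` J" \<kappa> J] order_refl)
  have cR: "card R = card (\<kappa> ` J)" using R by (simp add: card_image)
  obtain \<F> where \<F>: "finite \<F>" "pairwise disjnt \<F>"
      "\<forall>F\<in>\<F>. F \<subseteq> J - R \<and> card F = p \<and> (\<exists>c. \<forall>i\<in>F. \<kappa> i = c)"
      "card (J - R) \<le> p * card \<F> + (p - 1) * card (\<kappa> ` (J - R))"
    using disjoint_monochromatic_subsets[of "J - R" p \<kappa>] assms by auto
  have "card (\<kappa> ` (J - R)) \<le> card (\<kappa> ` J)" using assms by (intro card_mono) auto
  then have "(p - 1) * card (\<kappa> ` (J - R)) \<le> (p - 1) * card (\<kappa> ` J)" by simp
  moreover have "card J = card (J - R) + card R"
    using R(1) assms(1) by (metis card_Diff_subset card_mono finite_subset le_add_diff_inverse2)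
  moreover have "p * card (\<kappa> ` J) = (p - 1) * card (\<kappa> ` J) + card (\<kappa> ` J)"
    using assms(2) by (cases p) auto
  ultimately have "card J \<le> p * card \<F> + p * card (\<kappa> ` J)"
    using \<F>(4) cR by linarith
  moreover have "R \<subseteq> J - \<Union>\<F>" using R(1) \<F>(3) by blast
  then have "\<kappa> ` (J - \<Union>\<F>) = \<kappa> ` J" using R(3) by blast
  ultimately show ?thesis using \<F> by (intro exI[of _ \<F>]) blast
qed

lemma card_divisors_le:
  assumes "0 < (e::nat)" shows "2 * card {d. d dvd e} \<le> e + 2"
proof -
  have "{d. d dvd e} \<subseteq> insert e {1..e div 2}"
  proof
    fix d assume "d \<in> {d. d dvd e}"
    then obtain k where k: "e = d * k" by auto
    have "0 < k" "0 < d" using k assms by (auto intro: Nat.gr0I)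
    moreover have "d \<le> e div 2" if "k \<noteq> 1"
    proof -
      have "d * 2 \<le> d * k" using that \<open>0 < k\<close> by (intro mult_le_mono2) linarith
      then show ?thesis using k by linarith
    qed
    ultimately show "d \<in> insert e {1..e div 2}"
      using k by (cases "k = 1") auto
  qed
  then have "card {d. d dvd e} \<le> card (insert e {1..e div 2})" by (intro card_mono) auto
  also have "\<dots> \<le> e div 2 + 1" by (simp add: card_insert_if)
  finally show ?thesis by linarith
qed

lemma card_odd_le:
  assumes "\<And>k. k \<in> K \<Longrightarrow> odd k \<and> k \<le> (f::nat)" shows "2 * card K \<le> f + 1"
proof -
  have "K \<subseteq> (\<lambda>j. 2 * j + 1) ` {..<(f + 1) div 2}"
  proof
    fix k assume "k \<in> K"
    then obtain j where "k = 2 * j + 1" "k \<le> f" using assms by (blast elim: oddE)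
    then show "k \<in> (\<lambda>j. 2 * j + 1) ` {..<(f + 1) div 2}" by auto
  qed
  then have "card K \<le> card ((\<lambda>j. 2 * j + 1) ` {..<(f + 1) div 2})" by (intro card_mono) auto
  also have "\<dots> \<le> (f + 1) div 2" using card_image_le[of "{..<(f + 1) div 2}"] by simp
  finally show ?thesis by linarith
qed

section \<open>Orders, exponents and indices modulo a subgroup\<close>

locale finite_comm_group = comm_group +
  assumes finite_carrier: "finite (carrier G)"
begin

text \<open>For a subgroup \<open>A\<close> containing \<open>N\<close> this is the exponent of the
  quotient, for a singleton the order of a coset. Relative notions inside one group replace quotient
  groups, so blocks always refer to the same elements.\<close>

definition relexp :: "'a set \<Rightarrow> 'a set \<Rightarrow> nat" where
  "relexp N A = (LEAST k. 0 < k \<and> (\<forall>x\<in>A. x [^] k \<in> N))"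

abbreviation relord :: "'a set \<Rightarrow> 'a \<Rightarrow> nat" where
  "relord N x \<equiv> relexp N {x}"

text \<open>The subgroup generated by a subgroup \<open>N\<close> and \<open>y\<close>; natural
  exponents reach all of it because \<open>y\<close> has finite order.\<close>

definition adjoin :: "'a set \<Rightarrow> 'a \<Rightarrow> 'a set" where
  "adjoin N y = (\<lambda>(n, i). n \<otimes> y [^] (i::nat)) ` (N \<times> UNIV)"

lemma subgroup_finite: "subgroup N G \<Longrightarrow> finite N"
  using finite_carrier finite_subset subgroup.subset by blast

lemma subgroup_card_pos: "subgroup N G \<Longrightarrow> 0 < card N"
  using subgroup_finite subgroup.one_closed card_gt_0_iff by blast

lemma subgroup_nat_pow: "subgroup N G \<Longrightarrow> x \<in> N \<Longrightarrow> x [^] (k::nat) \<in> N"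
  by (induction k) (simp_all add: subgroup.one_closed subgroup.m_closed)

lemma subgroup_mult_cancel:
  assumes "subgroup N G" "x \<in> N" "y \<in> carrier G"
  shows "x \<otimes> y \<in> N \<longleftrightarrow> y \<in> N"
proof
  assume "x \<otimes> y \<in> N"
  then have "inv x \<otimes> (x \<otimes> y) \<in> N"
    using assms subgroup.m_inv_closed subgroup.m_closed by metis
  then show "y \<in> N"
    using assms subgroup.mem_carrier[OF assms(1,2)] by (simp flip: m_assoc)
qed (use assms subgroup.m_closed in metis)

lemma subgroupI_finite:
  assumes "H \<subseteq> carrier G" "\<one> \<in> H" "\<And>x y. x \<in> H \<Longrightarrow> y \<in> H \<Longrightarrow> x \<otimes> y \<in> H"
  shows "subgroup H G"
proof (rule subgroupI)
  fix a assume a: "a \<in> H"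
  then have aG: "a \<in> carrier G" using assms by blast
  have pow: "a [^] (k::nat) \<in> H" for k
    by (induction k) (use a assms in auto)
  have "0 < order G" using finite_carrier order_gt_0_iff_finite by blast
  then have "a [^] (order G - 1) \<otimes> a = \<one>"
    using pow_order_eq_1[OF aG] by (metis Suc_diff_1 nat_pow_Suc)
  then have "inv a = a [^] (order G - 1)"
    using aG by (simp add: inv_equality)
  then show "inv a \<in> H" using pow by metis
qed (use assms in auto)

lemma
  assumes "subgroup N G" "A \<subseteq> carrier G"
  shows relexp_dvd_iff: "relexp N A dvd j \<longleftrightarrow> (\<forall>x\<in>A. x [^] j \<in> N)"
    and relexp_pos: "0 < relexp N A"
proof -
  have "0 < order G" using finite_carrier order_gt_0_iff_finite by blast
  moreover have "\<forall>x\<in>A. x [^] order G \<in> N"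
    using assms pow_order_eq_1 subgroup.one_closed by (metis subset_iff)
  moreover have "(\<forall>x\<in>A. x [^] (a + b) \<in> N) \<longleftrightarrow> (\<forall>x\<in>A. x [^] b \<in> N)"
    if "\<forall>x\<in>A. x [^] a \<in> N" for a b :: nat
  proof (intro ball_cong refl)
    fix x assume "x \<in> A"
    then show "x [^] (a + b) \<in> N \<longleftrightarrow> x [^] b \<in> N"
      using that assms subgroup_mult_cancel[OF assms(1), of "x [^] a" "x [^] b"]
      by (metis nat_pow_closed nat_pow_mult subset_iff)
  qed
  ultimately have *: "\<forall>x\<in>A. x [^] order G \<in> N" "0 < order G"
      "\<And>a b::nat. \<forall>x\<in>A. x [^] a \<in> N \<Longrightarrow> (\<forall>x\<in>A. x [^] (a + b) \<in> N) \<longleftrightarrow> (\<forall>x\<in>A. x [^] b \<in> N)"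
    by simp_all
  show "relexp N A dvd j \<longleftrightarrow> (\<forall>x\<in>A. x [^] j \<in> N)"
    unfolding relexp_def
    by (rule dvd_iff_least_period(1)[OF *, symmetric])
  show "0 < relexp N A"
    unfolding relexp_def by (rule dvd_iff_least_period(2)[OF *])
qed

lemma relord_dvd_iff:
  assumes "subgroup N G" "x \<in> carrier G"
  shows "relord N x dvd j \<longleftrightarrow> x [^] j \<in> N"
  using relexp_dvd_iff[of N "{x}" j] assms by simp

lemma relord_pos: "subgroup N G \<Longrightarrow> x \<in> carrier G \<Longrightarrow> 0 < relord N x"
  using relexp_pos[of N "{x}"] by simp

lemma relord_trivial:
  assumes "x \<in> carrier G" shows "relord {\<one>} x = ord x"
proof (rule dvd_antisym)
  show "relord {\<one>} x dvd ord x"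
    using relord_dvd_iff[OF triv_subgroup assms, of "ord x"] assms by simp
  have "x [^] relord {\<one>} x = \<one>"
    using relord_dvd_iff[OF triv_subgroup assms, of "relord {\<one>} x"] by simp
  then show "ord x dvd relord {\<one>} x" using pow_eq_id[OF assms] by blast
qed

lemma relord_eq_1_iff: "subgroup N G \<Longrightarrow> x \<in> carrier G \<Longrightarrow> relord N x = 1 \<longleftrightarrow> x \<in> N"
  using relord_dvd_iff[of N x 1] by simp

lemma relord_eq_prime:
  assumes "subgroup N G" "x \<in> carrier G" "x \<notin> N" "x [^] p \<in> N" "Factorial_Ring.prime (p::nat)"
  shows "relord N x = p"
proof -
  have "relord N x dvd p" "relord N x \<noteq> 1"
    using assms relord_dvd_iff[of N x p] relord_eq_1_iff[of N x] by simp_all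
  then show ?thesis using assms(5) unfolding prime_nat_iff by blast
qed

lemma adjoin_subset: "subgroup M G \<Longrightarrow> N \<subseteq> M \<Longrightarrow> y \<in> M \<Longrightarrow> adjoin N y \<subseteq> M"
  unfolding adjoin_def by (auto intro!: subgroup.m_closed subgroup_nat_pow)

lemma adjoin_mem: "n \<in> N \<Longrightarrow> n \<otimes> y [^] (i::nat) \<in> adjoin N y"
  unfolding adjoin_def by force

lemma adjoin_superset: "N \<subseteq> carrier G \<Longrightarrow> N \<subseteq> adjoin N y"
proof
  fix n assume "N \<subseteq> carrier G" "n \<in> N"
  then show "n \<in> adjoin N y" using adjoin_mem[of n N y 0] by (simp add: subset_iff)
qed

lemma adjoin_self: "subgroup N G \<Longrightarrow> y \<in> carrier G \<Longrightarrow> y \<in> adjoin N y"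
  using adjoin_mem[of "\<one>" N y 1] subgroup.one_closed[of N G] by simp

lemma adjoin_subgroup:
  assumes "subgroup N G" "y \<in> carrier G"
  shows "subgroup (adjoin N y) G"
proof (rule subgroupI_finite)
  show "adjoin N y \<subseteq> carrier G"
    using adjoin_subset[OF subgroup_self] assms subgroup.subset by metis
  show "\<one> \<in> adjoin N y"
    using adjoin_superset[of N y] assms subgroup.subset subgroup.one_closed by blast
next
  fix u v assume "u \<in> adjoin N y" "v \<in> adjoin N y"
  then obtain n m and i j :: nat where *: "n \<in> N" "m \<in> N" "u = n \<otimes> y [^] i" "v = m \<otimes> y [^] j"
    unfolding adjoin_def by auto
  have "n \<in> carrier G" "m \<in> carrier G" using * assms subgroup.mem_carrier by metis+
  then have "u \<otimes> v = (n \<otimes> m) \<otimes> y [^] (i + j)"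
    using * assms by (simp add: m_ac nat_pow_mult[symmetric])
  then show "u \<otimes> v \<in> adjoin N y"
    using adjoin_mem * assms subgroup.m_closed by metis
qed

text \<open>The powers of \<open>y\<close> with exponents below \<open>relord N y\<close> represent
  the cosets of \<open>N\<close> without repetition.\<close>

lemma card_adjoin:
  assumes N: "subgroup N G" and y: "y \<in> carrier G"
  shows "card (adjoin N y) = relord N y * card N"
proof -
  let ?d = "relord N y" and ?h = "\<lambda>(n, i). n \<otimes> y [^] (i::nat)"
  note carr = subgroup.mem_carrier[OF N]
  have "adjoin N y = ?h ` (N \<times> {..<?d})"
  proof
    show "adjoin N y \<subseteq> ?h ` (N \<times> {..<?d})"
    proof
      fix u assume "u \<in> adjoin N y"
      then obtain n and i :: nat where *: "n \<in> N" "u = n \<otimes> y [^] i"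
        unfolding adjoin_def by auto
      have "y [^] i = y [^] (?d * (i div ?d)) \<otimes> y [^] (i mod ?d)"
        using y by (simp add: nat_pow_mult)
      moreover have yN: "y [^] (?d * (i div ?d)) \<in> N"
        using relord_dvd_iff[OF N y] by (metis dvd_triv_left)
      ultimately have "u = ?h (n \<otimes> y [^] (?d * (i div ?d)), i mod ?d)"
        using * y carr by (simp add: m_assoc)
      moreover have "i mod ?d < ?d" using relord_pos[OF N y] by simp
      ultimately show "u \<in> ?h ` (N \<times> {..<?d})"
        using * yN subgroup.m_closed[OF N] by blast
    qed
  qed (auto simp: adjoin_def)
  moreover have "inj_on ?h (N \<times> {..<?d})"
  proof -
    have key: "n = m \<and> i = j"
      if *: "n \<in> N" "m \<in> N" "i \<le> j" "j < ?d" "n \<otimes> y [^] i = m \<otimes> y [^] j" for n m and i j :: nat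
    proof -
      have "n \<otimes> y [^] i = (m \<otimes> y [^] (j - i)) \<otimes> y [^] i"
        using * y carr by (simp add: m_assoc nat_pow_mult)
      then have n: "n = m \<otimes> y [^] (j - i)" using * y carr by simp
      then have "y [^] (j - i) \<in> N" using subgroup_mult_cancel[OF N, of m] * y by simp
      then have "?d dvd j - i" using relord_dvd_iff[OF N y] by blast
      then have "j - i = 0" using * by (metis less_imp_diff_less nat_dvd_not_less neq0_conv)
      then show ?thesis using n * carr by simp
    qed
    show ?thesis
    proof (rule inj_onI, clarsimp)
      fix n m i j assume "n \<in> N" "m \<in> N" "i < ?d" "j < ?d" "n \<otimes> y [^] i = m \<otimes> y [^] j"
      then show "n = m \<and> i = j" using key[of n m i j] key[of m n j i] by (metis nat_le_linear)
    qed
  qed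
  ultimately show ?thesis by (simp add: card_image card_cartesian_product)
qed

lemma card_rcosets_within:
  assumes "subgroup M G" "subgroup N G" "N \<subseteq> M"
  shows "card ((\<lambda>x. N #> x) ` M) * card N = card M"
proof -
  interpret M: group "G\<lparr>carrier := M\<rparr>" by (rule subgroup.subgroup_is_group[OF assms(1) is_group])
  have "subgroup N (G\<lparr>carrier := M\<rparr>)" using assms subgroup_incl by blast
  moreover have "rcosets\<^bsub>G\<lparr>carrier := M\<rparr>\<^esub> N = (\<lambda>x. N #> x) ` M"
    by (auto simp: RCOSETS_def r_coset_def)
  ultimately show ?thesis using M.lagrange[of N] by (simp add: order_def)
qed

text \<open>The order of \<open>x\<close> modulo \<open>N\<close> is the index of \<open>N\<close>
  in \<open>adjoin N x\<close>, which divides \<open>n\<close> by Lagrange.\<close>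

lemma pow_index_mem:
  assumes "subgroup M G" "subgroup N G" "N \<subseteq> M" "card M = n * card N" "x \<in> M"
  shows "x [^] n \<in> N"
proof -
  have x: "x \<in> carrier G" using assms subgroup.mem_carrier by metis
  have "card (adjoin N x) dvd card M"
    using card_rcosets_within[of M "adjoin N x"] assms x adjoin_subgroup adjoin_subset
    by (metis dvd_triv_right)
  then have "relord N x dvd n"
    using card_adjoin[OF assms(2) x] assms subgroup_card_pos by simp
  then show ?thesis using relord_dvd_iff assms x by blast
qed

lemma finprod_mem:
  assumes "subgroup M G" "g ` T \<subseteq> M"
  shows "finprod G g T \<in> M"
  using assms(2)
proof (induction T rule: infinite_finite_induct)
  case (insert i T)
  have "g ` insert i T \<subseteq> carrier G" using insert.prems subgroup.subset[OF assms(1)] by blast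
  then have "finprod G g (insert i T) = g i \<otimes> finprod G g T"
    using insert.hyps by (intro finprod_insert) auto
  then show ?case using insert subgroup.m_closed[OF assms(1)] by auto
qed (use assms subgroup.one_closed in auto)

text \<open>Two prefix products lie in the same coset of \<open>N\<close>, and the terms in between
  multiply into \<open>N\<close>. Weights are left to the callers.\<close>

lemma exists_finprod_mem:
  fixes g :: "'i \<Rightarrow> 'a"
  assumes M: "subgroup M G" and N: "subgroup N G" and "N \<subseteq> M" "card M = n * card N"
    and "finite I" "g ` I \<subseteq> M" "n \<le> card I"
  shows "\<exists>T\<subseteq>I. T \<noteq> {} \<and> finprod G g T \<in> N"
proof -
  obtain h where h: "bij_betw h {0..<card I} I" using ex_bij_betw_nat_finite[OF assms(5)] by blast
  \<comment> \<open>Counting the empty prefix, \<open>n\<close> terms have \<open>n + 1\<close>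
    prefixes, one more than there are cosets.\<close>
  let ?s = "\<lambda>k. \<Otimes>i\<in>h ` {..<k}. g i"
  have sub: "h ` {..<k} \<subseteq> I" if "k \<le> card I" for k
    using h that unfolding bij_betw_def by force
  have sM: "?s k \<in> M" if "k \<le> card I" for k
    using sub[OF that] assms(6) by (intro finprod_mem[OF M]) blast
  have "card ((\<lambda>x. N #> x) ` M) = n"
    using card_rcosets_within[OF M N] assms subgroup_card_pos[OF N] by simp
  moreover have "(\<lambda>k. N #> ?s k) ` {..card I} \<subseteq> (\<lambda>x. N #> x) ` M" using sM by auto
  then have "card ((\<lambda>k. N #> ?s k) ` {..card I}) \<le> card ((\<lambda>x. N #> x) ` M)"
    using subgroup_finite[OF M] by (intro card_mono) auto
  ultimately have "card ((\<lambda>k. N #> ?s k) ` {..card I}) < card {..card I}"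
    using assms(7) by simp
  then have "\<not> inj_on (\<lambda>k. N #> ?s k) {..card I}" by (rule pigeonhole)
  then obtain a b where ab: "a < b" "b \<le> card I" "N #> ?s a = N #> ?s b"
    unfolding inj_on_def by (metis (no_types, lifting) atMost_iff nat_neq_iff)
  have carr: "g i \<in> carrier G" if "i \<in> I" for i
    using assms(6) that subgroup.mem_carrier[OF M] by blast
  let ?T = "h ` {a..<b}"
  have T: "?T \<subseteq> I" "?T \<noteq> {}" using h ab unfolding bij_betw_def by force+
  have inj: "inj_on h {..<b}"
    using h ab(2) unfolding bij_betw_def by (metis atLeast0LessThan inj_on_subset lessThan_subset_iff)
  have "{..<b} = {..<a} \<union> {a..<b}" using ab(1) by auto
  then have split: "h ` {..<b} = h ` {..<a} \<union> ?T" by (metis image_Un)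
  have disj: "h ` {..<a} \<inter> ?T = {}"
    using ab(1) inj unfolding inj_on_def by force
  have "?s b = ?s a \<otimes> finprod G g ?T"
    unfolding split using disj sub[of a] ab T carr by (intro finprod_Un_disjoint) auto
  moreover have "?s b \<in> N #> ?s a"
    using ab(3) sM[of b] ab(2) subgroup.mem_carrier[OF M] rcos_self N by simp
  then obtain n where "n \<in> N" "?s b = n \<otimes> ?s a" unfolding r_coset_def by blast
  moreover have "?s a \<in> carrier G" using sM[of a] ab subgroup.mem_carrier[OF M] by simp
  moreover have "finprod G g ?T \<in> carrier G" using T carr by (intro finprod_closed) blast
  moreover have "n \<in> carrier G" using \<open>n \<in> N\<close> subgroup.mem_carrier[OF N] by blast
  ultimately have "finprod G g ?T = n" by (metis m_comm r_cancel)
  then show ?thesis using T \<open>n \<in> N\<close> by blast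
qed

section \<open>Good blocks and the two induction statements\<close>

text \<open>Finiteness excludes sets on which product and sum take their default values. For trivial
  \<open>N\<close> the weight is that of the theorem.\<close>

definition good :: "'a set \<Rightarrow> ('i \<Rightarrow> 'a) \<Rightarrow> 'i set \<Rightarrow> bool" where
  "good N g T \<longleftrightarrow> finite T \<and> T \<noteq> {} \<and> finprod G g T \<in> N \<and>
     (\<Sum>i\<in>T. 1 / real (relord N (g i))) \<le> 1"

text \<open>Indices are natural numbers because a definition cannot quantify over types; other
  families are renumbered.\<close>

definition one_block :: "'a set \<Rightarrow> 'a set \<Rightarrow> nat \<Rightarrow> bool" where
  "one_block M N n \<longleftrightarrow> (\<forall>(g::nat \<Rightarrow> 'a) I. finite I \<and> g ` I \<subseteq> M \<and> n \<le> card I \<longrightarrow>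
     (\<exists>T\<subseteq>I. good N g T))"

text \<open>Each distinct order allows the sequence to be one term shorter. This saving later pays
  for the leftovers of grouping by order.\<close>

definition two_blocks :: "'a set \<Rightarrow> 'a set \<Rightarrow> nat \<Rightarrow> bool" where
  "two_blocks M N n \<longleftrightarrow> (\<forall>(g::nat \<Rightarrow> 'a) I. finite I \<and> g ` I \<subseteq> M \<and>
     2 * n < card I + card ((\<lambda>i. relord N (g i)) ` I) \<longrightarrow>
     (\<exists>T\<subseteq>I. \<exists>U\<subseteq>I. T \<inter> U = {} \<and> good N g T \<and> good N g U))"

lemma one_blockD:
  fixes g :: "nat \<Rightarrow> 'a"
  assumes "one_block M N n" "finite I" "g ` I \<subseteq> M" "n \<le> card I"
  shows "\<exists>T\<subseteq>I. good N g T"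
  using assms by (simp add: one_block_def)

lemma two_blocksD:
  fixes g :: "nat \<Rightarrow> 'a"
  assumes "two_blocks M N n" "finite I" "g ` I \<subseteq> M"
    "2 * n < card I + card ((\<lambda>i. relord N (g i)) ` I)"
  shows "\<exists>T\<subseteq>I. \<exists>U\<subseteq>I. T \<inter> U = {} \<and> good N g T \<and> good N g U"
  using assms by (simp add: two_blocks_def)

lemma relord_dvd_relexp:
  assumes "subgroup M G" "subgroup N G" "x \<in> M"
  shows "relord N x dvd relexp N M"
  using relexp_dvd_iff[OF assms(2) subgroup.subset[OF assms(1)], of "relexp N M"] assms(3)
    relord_dvd_iff[OF assms(2) subgroup.mem_carrier[OF assms(1,3)]] by simp

text \<open>Every term weighs at least \<open>1 / relexp N M\<close>, and the total is at most
  1.\<close>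

lemma card_good_le:
  assumes M: "subgroup M G" and N: "subgroup N G" and "g ` T \<subseteq> M" "good N g T"
  shows "card T \<le> relexp N M"
proof -
  let ?e = "relexp N M"
  have e: "0 < ?e" using relexp_pos[OF N subgroup.subset[OF M]] .
  have "real (card T) / real ?e = (\<Sum>i\<in>T. 1 / real ?e)" by simp
  also have "\<dots> \<le> (\<Sum>i\<in>T. 1 / real (relord N (g i)))"
  proof (rule sum_mono)
    fix i assume "i \<in> T"
    then have i: "g i \<in> M" using assms(3) by blast
    have "relord N (g i) \<le> ?e" using relord_dvd_relexp[OF M N i] e by (rule dvd_imp_le)
    moreover have "0 < relord N (g i)" using relord_pos[OF N] i subgroup.mem_carrier[OF M] by blast
    ultimately show "1 / real ?e \<le> 1 / real (relord N (g i))" by (simp add: frac_le)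
  qed
  also have "\<dots> \<le> 1" using assms(4) by (simp add: good_def)
  finally show ?thesis using e by (simp add: field_simps)
qed

lemma card_relords_le:
  assumes M: "subgroup M G" and N: "subgroup N G" and "g ` I \<subseteq> M"
  shows "2 * card ((\<lambda>i. relord N (g i)) ` I) \<le> relexp N M + 2"
proof -
  have e: "0 < relexp N M" using relexp_pos[OF N subgroup.subset[OF M]] .
  have "(\<lambda>i. relord N (g i)) ` I \<subseteq> {d. d dvd relexp N M}"
    using relord_dvd_relexp[OF M N] assms(3) by auto
  then have "card ((\<lambda>i. relord N (g i)) ` I) \<le> card {d. d dvd relexp N M}"
    using finite_divisors_nat[OF e] by (rule card_mono[rotated])
  then show ?thesis using card_divisors_le[OF e] by linarith
qed

lemma relexp_dvd_index:
  assumes "subgroup M G" "subgroup N G" "N \<subseteq> M" "card M = n * card N"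
  shows "relexp N M dvd n"
  using pow_index_mem[OF assms] relexp_dvd_iff[OF assms(2) subgroup.subset[OF assms(1)], of n] by simp

lemma index_pos:
  assumes "subgroup M G" "card M = n * card N"
  shows "0 < n"
  using subgroup_card_pos[OF assms(1)] assms(2) by (cases n) auto

text \<open>Greedy removal: a good block has at most \<open>relexp N M \<le> n\<close> terms, so
  each round consumes at most \<open>n\<close>.\<close>

lemma disjoint_blocks:
  fixes g :: "nat \<Rightarrow> 'a"
  assumes M: "subgroup M G" and N: "subgroup N G" "N \<subseteq> M" and n: "card M = n * card N"
    and one: "one_block M N n" and I: "finite I" "g ` I \<subseteq> M" "k * n \<le> card I"
  shows "\<exists>\<F>. finite \<F> \<and> card \<F> = k \<and> pairwise disjnt \<F> \<and> (\<forall>T\<in>\<F>. T \<subseteq> I \<and> good N g T)"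
  using I
proof (induction k arbitrary: I)
  case 0
  then show ?case by (intro exI[of _ "{}"]) auto
next
  case (Suc k)
  then obtain T where T: "T \<subseteq> I" "good N g T"
    using one_blockD[OF one, of I g] by auto
  have "relexp N M \<le> n"
    using relexp_dvd_index[OF M N n] index_pos[OF M n] by (rule dvd_imp_le)
  then have "card T \<le> n"
    using card_good_le[OF M N(1) _ T(2)] T(1) Suc.prems(2) by (meson image_mono order_trans)
  then have "k * n \<le> card (I - T)"
    using Suc.prems T by (simp add: card_Diff_subset finite_subset[OF T(1)])
  then obtain \<F> where \<F>: "finite \<F>" "card \<F> = k" "pairwise disjnt \<F>"
      "\<And>U. U \<in> \<F> \<Longrightarrow> U \<subseteq> I - T \<and> good N g U"
    using Suc.IH[of "I - T"] Suc.prems by (metis Diff_subset finite_Diff image_mono order_trans)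
  have "T \<noteq> {}" using T(2) by (simp add: good_def)
  then have "T \<notin> \<F>" using \<F>(4)[of T] by blast
  moreover have "pairwise disjnt (insert T \<F>)"
    using \<F>(3,4) unfolding pairwise_insert disjnt_def by blast
  ultimately show ?case
    using \<F> T by (intro exI[of _ "insert T \<F>"]) auto
qed

lemma disjoint_blocks_saving:
  fixes g :: "nat \<Rightarrow> 'a"
  assumes M: "subgroup M G" and N: "subgroup N G" "N \<subseteq> M" and n: "card M = n * card N"
    and one: "one_block M N n" and two: "two_blocks M N n"
    and I: "finite I" "g ` I \<subseteq> M" and "2 \<le> k"
    and card: "k * n < card I + card ((\<lambda>i. relord N (g i)) ` I)"
  shows "\<exists>\<F>. finite \<F> \<and> card \<F> = k \<and> pairwise disjnt \<F> \<and> (\<forall>T\<in>\<F>. T \<subseteq> I \<and> good N g T)"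
proof -
  let ?o = "\<lambda>i. relord N (g i)"
  define c where "c = card (?o ` I)"
  have n0: "0 < n" by (rule index_pos[OF M n])
  have "relexp N M \<le> n" using relexp_dvd_index[OF M N n] n0 by (rule dvd_imp_le)
  \<comment> \<open>This makes room for a representative of every order among
    \<open>2 * n + 1 - c\<close> terms.\<close>
  then have cn: "c \<le> n"
    using card_relords_le[OF M N(1) I(2)] n0 unfolding c_def by linarith
  obtain R where R: "R \<subseteq> I" "inj_on ?o R" "?o ` I = ?o ` R"
    using subset_image_inj[of "?o ` I" ?o I] by auto
  have cR: "card R = c" using R by (simp add: card_image c_def)
  obtain l where k: "k = 2 + l" using \<open>2 \<le> k\<close> le_Suc_ex by blast
  have big: "2 * n + l * n < card I + c" using card by (simp add: k c_def algebra_simps)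
  have "card R \<le> 2 * n + 1 - c" "2 * n + 1 - c \<le> card I" using cR cn big by linarith+
  then obtain J where J: "R \<subseteq> J" "J \<subseteq> I" "card J = 2 * n + 1 - c"
    using exists_subset_between[of R "2 * n + 1 - c" I] R(1) I(1) by blast
  have "?o ` J = ?o ` I" using J R(3) by blast
  then have "2 * n < card J + card (?o ` J)" using J(3) cn by (simp add: c_def)
  moreover have "finite J" "g ` J \<subseteq> M" using J I finite_subset by blast+
  ultimately obtain T U where TU: "T \<subseteq> J" "U \<subseteq> J" "T \<inter> U = {}" "good N g T" "good N g U"
    using two_blocksD[OF two, of J g] by blast
  have "card (I - J) = card I - card J" using J I by (simp add: card_Diff_subset finite_subset)
  then have "l * n \<le> card (I - J)" using J(3) cn big by linarith
  then obtain \<F> where \<F>: "finite \<F>" "card \<F> = l" "pairwise disjnt \<F>"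
      "\<And>V. V \<in> \<F> \<Longrightarrow> V \<subseteq> I - J \<and> good N g V"
    using disjoint_blocks[OF M N n one, of "I - J" g l] I by blast
  have ne: "T \<noteq> {}" "U \<noteq> {}" using TU by (simp_all add: good_def)
  have "T \<notin> insert U \<F>" "U \<notin> \<F>"
    using TU ne \<F>(4)[of T] \<F>(4)[of U] by blast+
  moreover have "pairwise disjnt (insert T (insert U \<F>))"
    using \<F>(3,4) TU unfolding pairwise_insert disjnt_def by blast
  moreover have "\<forall>V\<in>insert T (insert U \<F>). V \<subseteq> I \<and> good N g V"
    using \<F>(4) TU J by blast
  ultimately show ?thesis
    using \<F>(1,2) k by (intro exI[of _ "insert T (insert U \<F>)"]) auto
qed

text \<open>Each block acts as a single term, its product. The product weighs at least as much as
  the block, so a good set of products unfolds into a good set of original terms.\<close>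

lemma one_block_of_blocks:
  fixes g :: "nat \<Rightarrow> 'a"
  assumes one: "one_block M N n" and \<F>: "finite \<F>" "pairwise disjnt \<F>" "n \<le> card \<F>"
    and T: "\<And>T. T \<in> \<F> \<Longrightarrow> finite T \<and> T \<noteq> {} \<and> g ` T \<subseteq> carrier G \<and> finprod G g T \<in> M \<and>
      (\<Sum>i\<in>T. 1 / real (relord N (g i))) \<le> 1 / real (relord N (finprod G g T))"
  shows "\<exists>K\<subseteq>\<Union>\<F>. good N g K"
proof -
  obtain h where h: "bij_betw h {0..<card \<F>} \<F>" using ex_bij_betw_nat_finite[OF \<F>(1)] by blast
  let ?g = "\<lambda>j. finprod G g (h j)"
  have h\<F>: "h j \<in> \<F>" if "j \<in> {0..<card \<F>}" for j using h that unfolding bij_betw_def by blast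
  have "?g ` {0..<card \<F>} \<subseteq> M" using h\<F> T by blast
  then obtain A where A: "A \<subseteq> {0..<card \<F>}" "good N ?g A"
    using one_blockD[OF one, of "{0..<card \<F>}" ?g] \<F>(3) by auto
  have finA: "finite A" using A finite_subset by blast
  have hA: "h j \<in> \<F>" if "j \<in> A" for j using A h\<F> that by blast
  have disj: "h i \<inter> h j = {}" if "i \<in> A" "j \<in> A" "i \<noteq> j" for i j
  proof -
    have "h i \<noteq> h j" using h A that unfolding bij_betw_def inj_on_def by blast
    then show ?thesis using \<F>(2) hA that unfolding pairwise_def disjnt_def by blast
  qed
  let ?K = "\<Union>(h ` A)"
  have "finprod G g ?K = finprod G ?g A"
    using finA hA T disj by (intro finprod_UN_disjoint) (auto simp: pairwise_def disjnt_def image_subset_iff)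
  moreover have "(\<Sum>i\<in>?K. 1 / real (relord N (g i))) = (\<Sum>j\<in>A. \<Sum>i\<in>h j. 1 / real (relord N (g i)))"
    using finA hA T disj by (intro sum.UNION_disjoint) auto
  moreover have "\<dots> \<le> (\<Sum>j\<in>A. 1 / real (relord N (?g j)))"
    using hA T by (intro sum_mono) blast
  moreover have "finite ?K" using finA hA T by auto
  moreover have "?K \<noteq> {}" using A(2) hA T unfolding good_def by fastforce
  ultimately have "good N g ?K" using A(2) unfolding good_def by auto
  moreover have "?K \<subseteq> \<Union>\<F>" using hA by blast
  ultimately show ?thesis by blast
qed

end

section \<open>The layer \<open>L\<close> at a prime divisor of the exponent\<close>

lemma (in finite_comm_group) subgroup_pow_mem:
  assumes "subgroup M G" "subgroup N G"
  shows "subgroup {x \<in> M. x [^] (k::nat) \<in> N} G"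
proof (rule subgroupI_finite)
  show "{x \<in> M. x [^] k \<in> N} \<subseteq> carrier G" using subgroup.subset[OF assms(1)] by blast
  show "\<one> \<in> {x \<in> M. x [^] k \<in> N}"
    using subgroup.one_closed[OF assms(1)] subgroup.one_closed[OF assms(2)] by simp
next
  fix x y assume xy: "x \<in> {x \<in> M. x [^] k \<in> N}" "y \<in> {x \<in> M. x [^] k \<in> N}"
  then have "x \<in> carrier G" "y \<in> carrier G" using subgroup.mem_carrier[OF assms(1)] by blast+
  then have "(x \<otimes> y) [^] k = x [^] k \<otimes> y [^] k" by (rule nat_pow_distrib)
  then show "x \<otimes> y \<in> {x \<in> M. x [^] k \<in> N}"
    using xy subgroup.m_closed[OF assms(1)] subgroup.m_closed[OF assms(2)] by simp
qed

locale prime_layer = finite_comm_group +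
  fixes M N :: "'a set" and p :: nat
  assumes M: "subgroup M G" and N: "subgroup N G" and NM: "N \<subseteq> M"
    and p: "Factorial_Ring.prime p" and p_dvd: "p dvd relexp N M"
    and p_parity: "p = 2 \<or> odd (relexp N M)"
    \<comment> \<open>The parity condition only serves to bound the number of orders outside \<open>L\<close> by \<open>(f + 1) / 2\<close>.\<close>
begin

definition "e = relexp N M"
definition "q = e div p"
definition "L = {x \<in> M. x [^] q \<in> N}"
definition "f = card L div card N"

definition upper :: "'a \<Rightarrow> 'a set" where "upper x = adjoin L x"
definition lower :: "'a \<Rightarrow> 'a set" where "lower x = adjoin N (x [^] q)"

lemma e_eq: "e = p * q" using p_dvd by (simp add: e_def q_def)

lemma e_pos: "0 < e" unfolding e_def using relexp_pos[OF N subgroup.subset[OF M]] .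

lemma p_ge2: "2 \<le> p" using p by (rule prime_ge_2_nat)

lemma q_pos: "0 < q" using e_pos e_eq by simp

lemma M_carrier: "x \<in> M \<Longrightarrow> x \<in> carrier G"
  using subgroup.mem_carrier[OF M] .

lemma pow_e: "x \<in> M \<Longrightarrow> x [^] e \<in> N"
  using relexp_dvd_iff[OF N subgroup.subset[OF M], of e] by (simp add: e_def)

lemma L: "subgroup L G" unfolding L_def by (rule subgroup_pow_mem[OF M N])

lemma L_M: "L \<subseteq> M" unfolding L_def by blast

lemma N_L: "N \<subseteq> L" unfolding L_def using NM subgroup_nat_pow[OF N] by blast

lemma L_ne_M: "L \<noteq> M"
proof
  assume "L = M"
  then have "\<forall>x\<in>M. x [^] q \<in> N" unfolding L_def by blast
  then have "e dvd q" using relexp_dvd_iff[OF N subgroup.subset[OF M], of q] by (simp add: e_def)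
  then have "p * q \<le> 1 * q" using dvd_imp_le[OF _ q_pos] e_eq by simp
  then show False using q_pos p_ge2 by simp
qed

lemma card_L: "card L = f * card N"
  using card_rcosets_within[OF L N N_L] unfolding f_def by (metis dvd_div_mult_self dvd_triv_right)

lemma f_pos: "0 < f" by (rule index_pos[OF L card_L])

lemma pow_p_L: "x \<in> M \<Longrightarrow> x [^] p \<in> L"
  unfolding L_def using pow_e[of x] M_carrier[of x] subgroup_nat_pow[OF M, of x p]
  by (simp add: nat_pow_pow e_eq)

text \<open>The \<open>p\<close>-th power of an element of \<open>M\<close> lies in
  \<open>L\<close>, where \<open>f\<close>-th powers lie in \<open>N\<close>.\<close>

lemma e_le: "e \<le> p * f"
proof -
  have "x [^] (p * f) \<in> N" if "x \<in> M" for x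
    using pow_index_mem[OF L N N_L card_L pow_p_L[OF that]] M_carrier[OF that] by (simp add: nat_pow_pow)
  then have "e dvd p * f"
    using relexp_dvd_iff[OF N subgroup.subset[OF M], of "p * f"] by (simp add: e_def)
  then show ?thesis using f_pos p_ge2 by (intro dvd_imp_le) simp_all
qed

lemma q_le: "q \<le> f" using e_le e_eq p_ge2 by simp

text \<open>Let \<open>d\<close> be the order of \<open>x\<close> and \<open>e = d * k\<close>. If
  \<open>p\<close> divided \<open>k\<close>, then \<open>d\<close> would divide \<open>q\<close> and
  \<open>x\<close> would lie in \<open>L\<close>. So outside \<open>L\<close> orders carry the full
  power of \<open>p\<close> in \<open>e\<close>.\<close>

lemma top_order:
  assumes "x \<in> M - L"
  obtains d' k where "relord N x = p * d'" "q = d' * k" "\<not> p dvd k"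
proof -
  let ?d = "relord N x"
  have x: "x \<in> carrier G" using assms M_carrier by blast
  have "?d dvd e" using relord_dvd_relexp[OF M N] assms unfolding e_def by blast
  then obtain k where k: "e = ?d * k" by (rule dvdE)
  have nq: "\<not> ?d dvd q" using relord_dvd_iff[OF N x, of q] assms unfolding L_def by blast
  have nk: "\<not> p dvd k"
  proof
    assume "p dvd k"
    then obtain l where "k = p * l" by (rule dvdE)
    then have "q = ?d * l" using k e_eq p_ge2 by simp
    then show False using nq by simp
  qed
  have "p dvd ?d * k" using k e_eq by (metis dvd_triv_left)
  then have "p dvd ?d" using nk p prime_dvd_mult_iff by blast
  then obtain d' where d': "?d = p * d'" by (rule dvdE)
  then have "q = d' * k" using k e_eq p_ge2 by simp
  then show thesis using that d' nk by blast
qed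

lemma upper: assumes "x \<in> M" shows "subgroup (upper x) G" "L \<subseteq> upper x" "upper x \<subseteq> M" "x \<in> upper x"
  unfolding upper_def using adjoin_subgroup[OF L] adjoin_superset[of L x] adjoin_subset[OF M L_M assms]
    adjoin_self[OF L] M_carrier[OF assms] subgroup.subset[OF L] by blast+

lemma lower: assumes "x \<in> M" shows "subgroup (lower x) G" "N \<subseteq> lower x" "lower x \<subseteq> upper x"
proof -
  have xq: "x [^] q \<in> carrier G" using M_carrier[OF assms] by simp
  show "subgroup (lower x) G" unfolding lower_def using adjoin_subgroup[OF N xq] .
  show "N \<subseteq> lower x" unfolding lower_def using adjoin_superset subgroup.subset[OF N] by blast
  show "lower x \<subseteq> upper x" unfolding lower_def
    using N_L upper[OF assms] subgroup_nat_pow by (intro adjoin_subset) blast+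
qed

lemma card_upper: "x \<in> M - L \<Longrightarrow> card (upper x) = p * card L"
  unfolding upper_def using card_adjoin[OF L] relord_eq_prime[OF L _ _ pow_p_L p] M_carrier by auto

lemma card_lower: "x \<in> M - L \<Longrightarrow> card (lower x) = p * card N"
proof -
  assume x: "x \<in> M - L"
  have "x [^] q \<in> carrier G" "x [^] q \<notin> N" "(x [^] q) [^] p \<in> N"
    using x M_carrier[of x] pow_e[of x] unfolding L_def by (auto simp: nat_pow_pow e_eq mult.commute)
  then show ?thesis unfolding lower_def using card_adjoin[OF N] relord_eq_prime[OF N _ _ _ p] by metis
qed

text \<open>Adjoining \<open>x\<close> to \<open>L\<close> and \<open>x [^] q\<close> to
  \<open>N\<close> both multiply the size by \<open>p\<close>, so the index stays \<open>f\<close>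
  and the induction hypothesis applies to this pair.\<close>

lemma card_upper_lower: "x \<in> M - L \<Longrightarrow> card (upper x) = f * card (lower x)"
  by (simp add: card_upper card_lower card_L)

lemma pow_q_lower:
  assumes "x \<in> M" "z \<in> upper x"
  shows "z [^] q \<in> lower x"
proof -
  obtain n and i :: nat where n: "n \<in> L" "z = n \<otimes> x [^] i"
    using assms(2) unfolding upper_def adjoin_def by auto
  have x: "x \<in> carrier G" and nG: "n \<in> carrier G" using assms n(1) M_carrier L_M by blast+
  have "z [^] q = n [^] q \<otimes> (x [^] q) [^] i"
    using n(2) x nG by (simp add: nat_pow_distrib nat_pow_pow mult.commute)
  moreover have "n [^] q \<in> N" using n(1) unfolding L_def by blast
  ultimately show ?thesis unfolding lower_def by (simp add: adjoin_mem)
qed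

lemma lower_pow_p:
  assumes "x \<in> M" "z \<in> lower x"
  shows "z [^] p \<in> N"
proof -
  obtain n and i :: nat where n: "n \<in> N" "z = n \<otimes> (x [^] q) [^] i"
    using assms(2) unfolding lower_def adjoin_def by auto
  have x: "x \<in> carrier G" and nG: "n \<in> carrier G" using assms n(1) M_carrier NM by blast+
  have "z [^] p = n [^] p \<otimes> (x [^] e) [^] i"
    using n(2) x nG by (simp add: nat_pow_distrib nat_pow_pow e_eq mult_ac)
  then show ?thesis
    using subgroup_nat_pow[OF N] n(1) pow_e[OF assms(1)] subgroup.m_closed[OF N] by simp
qed

text \<open>The order over \<open>lower x\<close> divides \<open>d' * k\<close> and
  \<open>d' * p\<close>, hence \<open>d'\<close>, as \<open>k\<close> is prime to \<open>p\<close>;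
  conversely \<open>p\<close>-th powers from \<open>lower x\<close> fall into \<open>N\<close>. Thus
  weights over \<open>N\<close> are exactly \<open>1/p\<close> of those over
  \<open>lower x\<close>.\<close>

lemma relord_lower:
  assumes x: "x \<in> M" and z: "z \<in> upper x - L"
  shows "relord N z = p * relord (lower x) z"
proof -
  have zM: "z \<in> M - L" using z upper(3)[OF x] by blast
  then have zG: "z \<in> carrier G" using M_carrier by blast
  note lo = lower[OF x]
  obtain d' k where d: "relord N z = p * d'" "q = d' * k" "\<not> p dvd k" by (rule top_order[OF zM])
  let ?d = "relord (lower x) z"
  have "z [^] ?d \<in> lower x" using relord_dvd_iff[OF lo(1) zG, of ?d] by simp
  then have "z [^] (p * ?d) \<in> N" using lower_pow_p[OF x, of "z [^] ?d"] zG by (simp add: nat_pow_pow mult.commute)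
  then have "p * d' dvd p * ?d" using relord_dvd_iff[OF N zG] d(1) by metis
  moreover have "?d dvd d' * k"
    using pow_q_lower[OF x, of z] z relord_dvd_iff[OF lo(1) zG, of q] d(2) by simp
  moreover have "?d dvd d' * p"
    using relord_dvd_iff[OF N zG, of "d' * p"] lo(2) relord_dvd_iff[OF lo(1) zG, of "d' * p"] d(1)
    by (simp add: mult.commute subset_iff)
  moreover have "coprime k p" using d(3) p by (metis coprime_commute prime_imp_coprime)
  then have "gcd (d' * k) (d' * p) = d'" by (simp add: gcd_mult_distrib_nat[symmetric])
  ultimately have "d' dvd ?d" "?d dvd d'"
    using p_ge2 by (simp, metis gcd_greatest)
  then show ?thesis using d(1) dvd_antisym by metis
qed

text \<open>Inclusion and equal cardinality. Hence the classes \<open>upper x - L\<close> partition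
  \<open>M - L\<close>.\<close>

lemma upper_eq:
  assumes "x \<in> M - L" "z \<in> upper x - L"
  shows "upper z = upper x"
proof (rule card_subset_eq)
  have zM: "z \<in> M - L" using assms upper(3)[of x] by blast
  show "finite (upper x)" using assms upper(1) subgroup_finite by blast
  show "upper z \<subseteq> upper x"
    unfolding upper_def[of z] using assms upper[of x] by (intro adjoin_subset) blast+
  show "card (upper z) = card (upper x)" using card_upper assms zM by simp
qed

lemma card_M: "card M = card L * (1 + card (upper ` (M - L)) * (p - 1))"
proof -
  let ?U = "upper ` (M - L)"
  have fin: "finite M" "finite L" using subgroup_finite M L by blast+
  have "M - L = (\<Union>A\<in>?U. A - L)"
    using upper(3,4) by blast
  then have "card (M - L) = card (\<Union>A\<in>?U. A - L)" by simp
  also have "\<dots> = (\<Sum>A\<in>?U. card (A - L))"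
  proof (rule card_UN_disjoint)
    show "finite ?U" using fin by simp
    show "\<forall>A\<in>?U. finite (A - L)" using upper(1) subgroup_finite by blast
    show "\<forall>A\<in>?U. \<forall>B\<in>?U. A \<noteq> B \<longrightarrow> (A - L) \<inter> (B - L) = {}" using upper_eq by blast
  qed
  also have "\<dots> = (\<Sum>A\<in>?U. (p - 1) * card L)"
  proof (rule sum.cong[OF refl])
    fix A assume "A \<in> ?U"
    then obtain x where x: "x \<in> M - L" "A = upper x" by blast
    then have "card (A - L) = p * card L - card L"
      using card_Diff_subset[OF fin(2), of A] upper(2)[of x] card_upper[of x] by simp
    then show "card (A - L) = (p - 1) * card L" by (simp add: diff_mult_distrib)
  qed
  finally have "card (M - L) = card ?U * ((p - 1) * card L)" by simp
  moreover have "card M = card (M - L) + card L"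
    using card_Diff_subset[OF fin(2) L_M] card_mono[OF fin(1) L_M] by simp
  ultimately show ?thesis by (simp add: algebra_simps)
qed

lemma index_eq:
  assumes "card M = n * card N"
  shows "n = f * (1 + card (upper ` (M - L)) * (p - 1))"
proof -
  have "n * card N = f * (1 + card (upper ` (M - L)) * (p - 1)) * card N"
    using card_M card_L assms by (simp add: algebra_simps)
  then show ?thesis using subgroup_card_pos[OF N] by simp
qed

section \<open>The two ways of using terms outside \<open>L\<close>\<close>

text \<open>Blocks that are good over \<open>lower x\<close> weigh at most \<open>1/p\<close> over
  \<open>N\<close>. As \<open>N\<close> has index \<open>p\<close> in \<open>lower x\<close>,
  pigeonhole on \<open>p\<close> disjoint ones selects some that jointly multiply into
  \<open>N\<close>, with total weight at most 1.\<close>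

lemma collapse:
  fixes g :: "nat \<Rightarrow> 'a"
  assumes x: "x \<in> M - L" and one: "one_block (upper x) (lower x) f"
    and two: "two_blocks (upper x) (lower x) f"
    and J: "finite J" "g ` J \<subseteq> upper x - L"
    and card: "p * f < card J + card ((\<lambda>i. relord N (g i)) ` J)"
  shows "\<exists>T\<subseteq>J. good N g T"
proof -
  have xM: "x \<in> M" using x by blast
  note up = upper[OF xM] and lo = lower[OF xM]
  have ord: "relord N (g i) = p * relord (lower x) (g i)" if "i \<in> J" for i
    using relord_lower[OF xM, of "g i"] J(2) that by blast
  \<comment> \<open>All orders change by the same factor, so equally many distinct ones occur over
    \<open>lower x\<close>.\<close>
  have "(\<lambda>i. relord N (g i)) ` J = (\<lambda>d. p * d) ` (\<lambda>i. relord (lower x) (g i)) ` J"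
    using ord by (simp add: image_image)
  moreover have "inj (\<lambda>d::nat. p * d)" using p_ge2 by (intro injI) simp
  ultimately have "card ((\<lambda>i. relord N (g i)) ` J) = card ((\<lambda>i. relord (lower x) (g i)) ` J)"
    using card_image inj_on_subset by (metis subset_UNIV)
  then have "p * f < card J + card ((\<lambda>i. relord (lower x) (g i)) ` J)" using card by simp
  moreover have "g ` J \<subseteq> upper x" using J(2) by blast
  ultimately obtain \<F> where \<F>: "finite \<F>" "card \<F> = p" "pairwise disjnt \<F>"
      "\<And>T. T \<in> \<F> \<Longrightarrow> T \<subseteq> J \<and> good (lower x) g T"
    using disjoint_blocks_saving[OF up(1) lo(1,3) card_upper_lower[OF x] one two J(1) _ p_ge2, of g] by blast
  have "finprod G g ` \<F> \<subseteq> lower x" using \<F>(4) unfolding good_def by blast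
  then obtain \<T> where \<T>: "\<T> \<subseteq> \<F>" "\<T> \<noteq> {}" "finprod G (finprod G g) \<T> \<in> N"
    using exists_finprod_mem[OF lo(1) N lo(2) card_lower[OF x] \<F>(1)] \<F>(2) by blast
  have fin: "finite \<T>" using \<T>(1) \<F>(1) finite_subset by blast
  have gG: "g i \<in> carrier G" if "i \<in> J" for i using that J(2) up(3) M_carrier by blast
  have T: "finite T" "T \<subseteq> J" "T \<noteq> {}" "(\<Sum>i\<in>T. 1 / real (relord (lower x) (g i))) \<le> 1"
    if "T \<in> \<T>" for T
    using \<F>(4)[of T] \<T>(1) that unfolding good_def by blast+
  have disj: "pairwise disjnt \<T>" using \<F>(3) \<T>(1) pairwise_subset by blast
  have "finprod G g (\<Union>\<T>) = finprod G (finprod G g) \<T>"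
    using fin T gG disj by (intro finprod_Union_disjoint) blast+
  moreover have "(\<Sum>i\<in>\<Union>\<T>. 1 / real (relord N (g i))) \<le> 1"
  proof -
    have "(\<Sum>i\<in>\<Union>\<T>. 1 / real (relord N (g i))) = (\<Sum>T\<in>\<T>. \<Sum>i\<in>T. 1 / real (relord N (g i)))"
      using disj T(1) by (subst sum.Union_disjoint) (auto simp: pairwise_def disjnt_def)
    also have "\<dots> \<le> (\<Sum>T\<in>\<T>. 1 / real p)"
    proof (rule sum_mono)
      fix t assume t: "t \<in> \<T>"
      have "(\<Sum>i\<in>t. 1 / real (relord N (g i))) = (\<Sum>i\<in>t. 1 / real (relord (lower x) (g i))) / real p"
        using ord T(2)[OF t] by (subst sum_divide_distrib) (auto intro!: sum.cong simp: subset_iff)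
      also have "\<dots> \<le> 1 / real p" using T(4)[OF t] by (intro divide_right_mono) auto
      finally show "(\<Sum>i\<in>t. 1 / real (relord N (g i))) \<le> 1 / real p" .
    qed
    also have "\<dots> = real (card \<T>) / real p" by simp
    also have "\<dots> \<le> 1" using card_mono[OF \<F>(1) \<T>(1)] \<F>(2) p_ge2 by simp
    finally show ?thesis .
  qed
  moreover have "finite (\<Union>\<T>)" "\<Union>\<T> \<noteq> {}" "\<Union>\<T> \<subseteq> J" using fin T(1,2,3) \<T>(2) by blast+
  ultimately have "good N g (\<Union>\<T>)" using \<T>(3) unfolding good_def by simp
  then show ?thesis using \<open>\<Union>\<T> \<subseteq> J\<close> by blast
qed

text \<open>Pigeonhole in \<open>upper x\<close> modulo \<open>L\<close> gives at most
  \<open>p\<close> terms with product in \<open>L\<close>. The order of the product divides both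
  \<open>d\<close> and \<open>q\<close>, hence \<open>d div p\<close>, so it weighs at least
  \<open>p / d\<close>, the most these terms can weigh.\<close>

lemma move_down:
  fixes g :: "nat \<Rightarrow> 'a"
  assumes x: "x \<in> M - L" and J: "g ` J \<subseteq> upper x - L" "card J = p"
    and d: "\<And>i. i \<in> J \<Longrightarrow> relord N (g i) = d"
  shows "\<exists>T\<subseteq>J. finite T \<and> T \<noteq> {} \<and> g ` T \<subseteq> carrier G \<and> finprod G g T \<in> L \<and>
      (\<Sum>i\<in>T. 1 / real (relord N (g i))) \<le> 1 / real (relord N (finprod G g T))"
proof -
  have finJ: "finite J" using J(2) p_ge2 card.infinite by fastforce
  have xM: "x \<in> M" using x by blast
  note up = upper[OF xM]
  have "g ` J \<subseteq> upper x" using J(1) by blast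
  then obtain T where T: "T \<subseteq> J" "T \<noteq> {}" "finprod G g T \<in> L"
    using exists_finprod_mem[OF up(1) L up(2) card_upper[OF x] finJ, of g] J(2) by blast
  let ?t = "finprod G g T"
  have tG: "?t \<in> carrier G" using T(3) L_M M_carrier by blast
  have gM: "g i \<in> M - L" if "i \<in> J" for i using J(1) up(3) that by blast
  obtain i where i: "i \<in> J" using T by blast
  obtain d' k where d': "d = p * d'" "q = d' * k" "\<not> p dvd k"
    using top_order[OF gM[OF i]] d[OF i] by metis
  have d'0: "0 < d'" using d'(2) q_pos by (cases d') auto
  have "g ` T \<subseteq> {z \<in> M. z [^] d \<in> N}"
    using gM d relord_dvd_iff[OF N] M_carrier T(1) by (auto simp: subset_iff) (metis dvd_refl)
  then have "?t \<in> {z \<in> M. z [^] d \<in> N}"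
    by (rule finprod_mem[OF subgroup_pow_mem[OF M N]])
  then have "relord N ?t dvd d' * p" using relord_dvd_iff[OF N tG] d'(1) by (simp add: mult.commute)
  moreover have "relord N ?t dvd d' * k" using relord_dvd_iff[OF N tG] d'(2) T(3) unfolding L_def by simp
  moreover have "coprime k p" using d'(3) p by (metis coprime_commute prime_imp_coprime)
  then have "gcd (d' * k) (d' * p) = d'" by (simp add: gcd_mult_distrib_nat[symmetric])
  ultimately have "relord N ?t dvd d'" by (metis gcd_greatest)
  then have le: "relord N ?t \<le> d'" using d'0 by (rule dvd_imp_le)
  have pos: "0 < relord N ?t" by (rule relord_pos[OF N tG])
  have "(\<Sum>i\<in>T. 1 / real (relord N (g i))) = (\<Sum>i\<in>T. 1 / real d)"
    using d T(1) by (intro sum.cong) auto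
  also have "\<dots> = real (card T) / (real p * real d')" by (simp add: d'(1))
  also have "\<dots> \<le> real p / (real p * real d')"
    using card_mono[OF finJ T(1)] J(2) by (intro divide_right_mono) auto
  also have "\<dots> = 1 / real d'" using p_ge2 by simp
  also have "\<dots> \<le> 1 / real (relord N ?t)" using le pos by (intro divide_left_mono) auto
  finally have "(\<Sum>i\<in>T. 1 / real (relord N (g i))) \<le> 1 / real (relord N ?t)" .
  moreover have "g ` T \<subseteq> carrier G" using T(1) gM M_carrier by blast
  moreover have "finite T" using T(1) finJ finite_subset by blast
  ultimately show ?thesis using T by blast
qed

end

section \<open>The induction steps for one block and for two blocks\<close>

context prime_layer
begin

text \<open>Terms of \<open>S\<close> count as singleton blocks and each group shrinks to a block
  from \<open>move_down\<close>. These are at least \<open>f\<close> blocks with products in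
  \<open>L\<close>.\<close>

lemma good_from_moves:
  fixes g :: "nat \<Rightarrow> 'a"
  assumes one: "one_block L N f" and S: "finite S" "g ` S \<subseteq> L"
    and \<F>: "finite \<F>" "pairwise disjnt \<F>" "f \<le> card S + card \<F>"
    and F: "\<And>F. F \<in> \<F> \<Longrightarrow> g ` F \<subseteq> M - L \<and> card F = p \<and> (\<exists>A d. \<forall>i\<in>F. upper (g i) = A \<and> relord N (g i) = d)"
  shows "\<exists>K\<subseteq>S \<union> \<Union>\<F>. good N g K"
proof -
  let ?P = "\<lambda>T. finite T \<and> T \<noteq> {} \<and> g ` T \<subseteq> carrier G \<and> finprod G g T \<in> L \<and>
      (\<Sum>i\<in>T. 1 / real (relord N (g i))) \<le> 1 / real (relord N (finprod G g T))"
  have "\<exists>T\<subseteq>E. ?P T" if E: "E \<in> \<F>" for E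
  proof -
    obtain A d where Ad: "\<And>i. i \<in> E \<Longrightarrow> upper (g i) = A \<and> relord N (g i) = d" using F[OF E] by blast
    have EM: "g ` E \<subseteq> M - L" and cE: "card E = p" using F[OF E] by blast+
    have "E \<noteq> {}" using cE p_ge2 by auto
    then obtain j where j: "j \<in> E" by blast
    have gj: "g j \<in> M - L" using EM j by blast
    have "g ` E \<subseteq> upper (g j) - L"
    proof
      fix z assume "z \<in> g ` E"
      then obtain i where i: "i \<in> E" "z = g i" by blast
      then have "g i \<in> M - L" using EM by blast
      then show "z \<in> upper (g j) - L" using upper(4)[of "g i"] Ad[OF i(1)] Ad[OF j] i(2) by simp
    qed
    then show ?thesis using move_down[OF gj _ cE, of g d] Ad by blast
  qed
  then obtain t where t: "\<And>E. E \<in> \<F> \<Longrightarrow> t E \<subseteq> E \<and> ?P (t E)" by metis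
  let ?B = "(\<lambda>i. {i}) ` S \<union> t ` \<F>"
  have SF: "i \<notin> E" if "i \<in> S" "E \<in> \<F>" for i E using that S(2) F[of E] by blast
  have disjF: "D \<inter> E = {}" if "D \<in> \<F>" "E \<in> \<F>" "D \<noteq> E" for D E
    using \<F>(2) that unfolding pairwise_def disjnt_def by blast
  have disjt: "t D \<inter> t E = {}" if "D \<in> \<F>" "E \<in> \<F>" "D \<noteq> E" for D E
    using disjF[OF that] t[OF that(1)] t[OF that(2)] by blast
  \<comment> \<open>The chosen subsets are nonempty and disjoint, so different groups give different
    blocks.\<close>
  have inj: "inj_on t \<F>"
  proof (rule inj_onI, rule ccontr)
    fix D E assume *: "D \<in> \<F>" "E \<in> \<F>" "t D = t E" "D \<noteq> E"
    then have "t D = {}" using disjt[of D E] by simp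
    then show False using t[of D] * by simp
  qed
  have "card ?B = card S + card \<F>"
  proof -
    have "(\<lambda>i. {i}) ` S \<inter> t ` \<F> = {}" using SF t by blast
    then have "card ?B = card ((\<lambda>i. {i}) ` S) + card (t ` \<F>)"
      using S(1) \<F>(1) by (intro card_Un_disjoint) auto
    then show ?thesis using inj by (simp add: card_image)
  qed
  then have "f \<le> card ?B" using \<F>(3) by simp
  moreover have "finite ?B" using S(1) \<F>(1) by simp
  moreover have "pairwise disjnt ?B"
  proof (rule pairwiseI)
    fix A B assume AB: "A \<in> ?B" "B \<in> ?B" "A \<noteq> B"
    have 1: "disjnt {i} (t E)" if "i \<in> S" "E \<in> \<F>" for i E
      using SF[OF that] t[OF that(2)] unfolding disjnt_def by blast
    have 2: "disjnt (t D) (t E)" if "D \<in> \<F>" "E \<in> \<F>" "t D \<noteq> t E" for D E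
      using disjt[of D E] that unfolding disjnt_def by blast
    consider i j where "A = {i}" "B = {j}" | i E where "A = {i}" "B = t E" "i \<in> S" "E \<in> \<F>"
      | i E where "B = {i}" "A = t E" "i \<in> S" "E \<in> \<F>"
      | D E where "A = t D" "B = t E" "D \<in> \<F>" "E \<in> \<F>"
      using AB(1,2) by blast
    then show "disjnt A B" using 1 2 AB(3) by cases (auto intro: disjnt_sym)
  qed
  moreover have "?P T" if T: "T \<in> ?B" for T
  proof (cases "T \<in> t ` \<F>")
    case True
    then show ?thesis using t by blast
  next
    case False
    then obtain i where i: "i \<in> S" "T = {i}" using T by blast
    have "g i \<in> L" using S(2) i(1) by blast
    moreover have "g i \<in> carrier G" using \<open>g i \<in> L\<close> L_M M_carrier by blast
    ultimately show ?thesis using i(2) by simp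
  qed
  ultimately obtain K where K: "K \<subseteq> \<Union>?B" "good N g K"
    using one_block_of_blocks[OF one, of ?B g] by blast
  have "\<Union>?B \<subseteq> S \<union> \<Union>\<F>" using t by blast
  then have "K \<subseteq> S \<union> \<Union>\<F>" using K(1) by (rule order_trans[rotated])
  then show ?thesis using K(2) by (intro exI[of _ K] conjI)
qed

text \<open>If no class collapses, terms plus orders number at most \<open>p * f\<close> in each
  class. This bounds both the terms outside \<open>L\<close> and the leftovers of grouping, so
  enough groups can be moved into \<open>L\<close>.\<close>

lemma one_block_step:
  assumes oneL: "one_block L N f"
    and up1: "\<And>x. x \<in> M - L \<Longrightarrow> one_block (upper x) (lower x) f"
    and up2: "\<And>x. x \<in> M - L \<Longrightarrow> two_blocks (upper x) (lower x) f"
    and n: "card M = n * card N"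
  shows "one_block M N n"
  unfolding one_block_def
proof (intro allI impI, elim conjE)
  fix g :: "nat \<Rightarrow> 'a" and I assume I: "finite I" "g ` I \<subseteq> M" "n \<le> card I"
  define S where "S = {i \<in> I. g i \<in> L}"
  define J where "J = I - S"
  let ?o = "\<lambda>i. relord N (g i)" and ?U = "upper ` (M - L)"
  have fin: "finite S" "finite J" "finite ?U"
    using I(1) subgroup_finite[OF M] by (simp_all add: S_def J_def)
  have gJ: "g i \<in> M - L" if "i \<in> J" for i using that I(2) unfolding S_def J_def by blast
  have gS: "g ` S \<subseteq> L" unfolding S_def by blast
  have cI: "card I = card S + card J"
    unfolding J_def using I(1) card_Diff_subset[OF fin(1), of I] card_mono[of I S] by (auto simp: S_def)
  have nf: "n = f * (1 + card ?U * (p - 1))" by (rule index_eq[OF n])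
  define JA where "JA A = {i \<in> J. upper (g i) = A}" for A
  have finJA: "finite (JA A)" for A using fin(2) unfolding JA_def by simp
  show "\<exists>T\<subseteq>I. good N g T"
  proof (cases "\<exists>x\<in>M - L. p * f < card (JA (upper x)) + card (?o ` JA (upper x))")
    case True
    then obtain x where x: "x \<in> M - L" "p * f < card (JA (upper x)) + card (?o ` JA (upper x))" by blast
    have gA: "g ` JA (upper x) \<subseteq> upper x - L"
      using gJ upper(4) unfolding JA_def by force
    obtain T where "T \<subseteq> JA (upper x)" "good N g T"
      using collapse[OF x(1) up1[OF x(1)] up2[OF x(1)] finJA gA x(2)] by blast
    then show ?thesis unfolding JA_def J_def by blast
  next
    case False
    \<comment> \<open>A colour fixes class and order, as \<open>move_down\<close> demands; the
      colours number at most the orders summed over the classes.\<close>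
    let ?k = "\<lambda>i. (upper (g i), ?o i)"
    obtain \<F> where \<F>: "finite \<F>" "pairwise disjnt \<F>"
        "\<And>F. F \<in> \<F> \<Longrightarrow> F \<subseteq> J \<and> card F = p \<and> (\<exists>c. \<forall>i\<in>F. ?k i = c)"
        "card J \<le> p * card \<F> + (p - 1) * card (?k ` J)"
      using disjoint_monochromatic_subsets[OF fin(2), of p ?k] p_ge2 by auto
    have "J = (\<Union>A\<in>?U. JA A)" using gJ unfolding JA_def by blast
    then have "card J = card (\<Union>A\<in>?U. JA A)" by simp
    also have "\<dots> = (\<Sum>A\<in>?U. card (JA A))"
      using fin(3) finJA by (intro card_UN_disjoint) (auto simp: JA_def)
    finally have cJ: "card J = (\<Sum>A\<in>?U. card (JA A))" .
    have "?k ` J \<subseteq> (SIGMA A:?U. ?o ` JA A)" using gJ unfolding JA_def by auto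
    then have "card (?k ` J) \<le> card (SIGMA A:?U. ?o ` JA A)"
      using fin(3) finJA by (intro card_mono) auto
    also have "\<dots> = (\<Sum>A\<in>?U. card (?o ` JA A))" using fin(3) finJA by simp
    finally have "card J + card (?k ` J) \<le> (\<Sum>A\<in>?U. card (JA A) + card (?o ` JA A))"
      using cJ by (simp add: sum.distrib)
    also have "\<dots> \<le> (\<Sum>A\<in>?U. p * f)" using False by (intro sum_mono) force
    finally have "card J + card (?k ` J) \<le> card ?U * (p * f)" by simp
    \<comment> \<open>Splitting \<open>p * card J\<close> into
      \<open>card J + (p - 1) * card J\<close> matches the \<open>p - 1\<close> leftovers per colour
      with the bound on terms plus colours. The outcome is
      \<open>card J \<le> card \<F> + (n - f)\<close>.\<close>
    then have "(p - 1) * (card J + card (?k ` J)) \<le> (p - 1) * (card ?U * (p * f))" by simp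
    moreover have "p * card J = card J + (p - 1) * card J" using p_ge2 by (cases p) auto
    ultimately have "p * card J \<le> p * card \<F> + (p - 1) * (card ?U * (p * f))"
      using \<F>(4) unfolding distrib_left by linarith
    also have "\<dots> = p * (card \<F> + (p - 1) * card ?U * f)" by (simp add: algebra_simps)
    finally have "card J \<le> card \<F> + (p - 1) * card ?U * f" using p_ge2 by simp
    moreover have "n = f + (p - 1) * card ?U * f" using nf by (simp add: algebra_simps)
    ultimately have "f \<le> card S + card \<F>" using cI I(3) by linarith
    moreover have "g ` F \<subseteq> M - L \<and> card F = p \<and> (\<exists>A d. \<forall>i\<in>F. upper (g i) = A \<and> ?o i = d)"
      if F: "F \<in> \<F>" for F
    proof -
      have "F \<subseteq> J" "card F = p" using \<F>(3)[OF F] by blast+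
      moreover obtain c where "\<And>i. i \<in> F \<Longrightarrow> ?k i = c" using \<F>(3)[OF F] by blast
      then have "\<forall>i\<in>F. upper (g i) = fst c \<and> ?o i = snd c" by force
      ultimately show ?thesis using gJ by blast
    qed
    ultimately obtain K where "K \<subseteq> S \<union> \<Union>\<F>" "good N g K"
      using good_from_moves[OF oneL fin(1) gS \<F>(1,2)] by blast
    moreover have "S \<union> \<Union>\<F> \<subseteq> I" using \<F>(3) unfolding S_def J_def by blast
    ultimately show ?thesis by blast
  qed
qed

text \<open>An order \<open>d\<close> outside \<open>L\<close> is determined by its cofactor \<open>e div d\<close>, an odd divisor of \<open>q \<le> f\<close>.\<close>

lemma card_top_orders:
  assumes "g ` J \<subseteq> M - L"
  shows "2 * card ((\<lambda>i. relord N (g i)) ` J) \<le> f + 1"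
proof -
  let ?D = "(\<lambda>i. relord N (g i)) ` J"
  have D: "d dvd e \<and> odd (e div d) \<and> e div d \<le> f" if "d \<in> ?D" for d
  proof -
    obtain i where i: "i \<in> J" "d = relord N (g i)" using \<open>d \<in> ?D\<close> by auto
    then have "g i \<in> M - L" using assms by blast
    then obtain d' k where *: "d = p * d'" "q = d' * k" "\<not> p dvd k"
      using top_order i(2) by metis
    have ek: "e = d * k" using * e_eq by simp
    have d'0: "0 < d'" "0 < k" using *(2) q_pos by (auto intro: Nat.gr0I)
    have k: "e div d = k" using ek d'0 *(1) p_ge2 by simp
    have "odd k"
    proof (cases "p = 2")
      case True
      then show ?thesis using *(3) by simp
    next
      case False
      then have "odd e" using p_parity by (simp add: e_def)
      then show ?thesis using ek by simp
    qed
    moreover have "k \<le> q" using *(2) d'0 by simp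
    then have "k \<le> f" using q_le by simp
    ultimately show ?thesis using k ek by simp
  qed
  have "inj_on (\<lambda>d. e div d) ?D"
  proof (rule inj_onI)
    fix a b assume ab: "a \<in> ?D" "b \<in> ?D" "e div a = e div b"
    have "a * (e div a) = b * (e div b)" using D[OF ab(1)] D[OF ab(2)] by simp
    moreover have "0 < e div b" using D[OF ab(2)] by (metis even_zero neq0_conv)
    ultimately show "a = b" using ab(3) by simp
  qed
  then have "card ?D = card ((\<lambda>d. e div d) ` ?D)" by (simp add: card_image)
  also have "2 * \<dots> \<le> f + 1" using D by (intro card_odd_le) blast
  finally show ?thesis .
qed

text \<open>Several classes make \<open>e\<close> small against \<open>n\<close>. With a single
  class \<open>n = p * f\<close>, and either both blocks come from \<open>L\<close>, or one comes
  from \<open>L\<close>, possibly after moving terms down, and one from a collapse.\<close>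

lemma two_blocks_step:
  assumes oneL: "one_block L N f" and twoL: "two_blocks L N f"
    and up1: "\<And>x. x \<in> M - L \<Longrightarrow> one_block (upper x) (lower x) f"
    and up2: "\<And>x. x \<in> M - L \<Longrightarrow> two_blocks (upper x) (lower x) f"
    and n: "card M = n * card N" and one: "one_block M N n"
  shows "two_blocks M N n"
  unfolding two_blocks_def
proof (intro allI impI, elim conjE)
  fix g :: "nat \<Rightarrow> 'a" and I
  let ?o = "\<lambda>i. relord N (g i)" and ?U = "upper ` (M - L)"
  assume I: "finite I" "g ` I \<subseteq> M" and large: "2 * n < card I + card (?o ` I)"
  have nf: "n = f * (1 + card ?U * (p - 1))" by (rule index_eq[OF n])
  obtain x where x: "x \<in> M - L" using L_M L_ne_M by blast
  have "finite ?U" using subgroup_finite[OF M] by simp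
  then have U0: "card ?U \<noteq> 0" using x by auto
  show "\<exists>T\<subseteq>I. \<exists>U\<subseteq>I. T \<inter> U = {} \<and> good N g T \<and> good N g U"
  proof (cases "card ?U = 1")
    case False
    \<comment> \<open>A block has at most \<open>e\<close> terms, and \<open>e\<close> is so small that two blocks can be removed greedily.\<close>
    have "f * (1 + 2 * (p - 1)) \<le> n" unfolding nf using False U0 by (intro mult_le_mono2) auto
    moreover have "3 * p \<le> 2 * (1 + 2 * (p - 1))" using p_ge2 by simp
    then have "f * (3 * p) \<le> f * (2 * (1 + 2 * (p - 1)))" by (rule mult_le_mono2)
    ultimately have "3 * (p * f) \<le> 2 * n" by (simp add: algebra_simps)
    then have e3: "3 * e \<le> 2 * n" using e_le by linarith
    have c: "2 * card (?o ` I) \<le> e + 2" using card_relords_le[OF M N I(2)] by (simp add: e_def)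
    have "n \<le> card I" using large c e3 by linarith
    then obtain T where T: "T \<subseteq> I" "good N g T" using one_blockD[OF one I] by blast
    have "card T \<le> e" unfolding e_def using T I(2) by (intro card_good_le[OF M N]) auto
    moreover have "card (I - T) = card I - card T"
      using T I(1) by (intro card_Diff_subset finite_subset[OF T(1)])
    \<comment> \<open>The bounds give
      \<open>2 * (card I - e) > 4 * n - 3 * e - 2 \<ge> 2 * n - 2\<close>, and integrality does the
      rest.\<close>
    ultimately have "n \<le> card (I - T)" using large c e3 by linarith
    moreover have "g ` (I - T) \<subseteq> M" using I(2) by blast
    ultimately obtain V where "V \<subseteq> I - T" "good N g V"
      using one_blockD[OF one, of "I - T" g] I(1) by blast
    then show ?thesis using T by blast
  next
    case True
    then have npf: "n = p * f" using nf p_ge2 by (simp add: mult.commute)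
    have upx: "upper z = upper x" if "z \<in> M - L" for z
      using True x that by (metis card_1_singletonE image_eqI singletonD)
    define S where "S = {i \<in> I. g i \<in> L}"
    define J where "J = I - S"
    have fin: "finite S" "finite J" using I(1) by (simp_all add: S_def J_def)
    have gJ: "g ` J \<subseteq> M - L" using I(2) unfolding S_def J_def by blast
    have gS: "g ` S \<subseteq> L" unfolding S_def by blast
    have SI: "S \<subseteq> I" "J \<subseteq> I" "S \<inter> J = {}" "I = S \<union> J" unfolding S_def J_def by blast+
    have cI: "card I = card S + card J"
      using card_Un_disjoint[OF fin SI(3)] SI(4) by simp
    have "?o ` I = ?o ` S \<union> ?o ` J" using SI(4) by blast
    then have "card (?o ` I) \<le> card (?o ` S) + card (?o ` J)" using card_Un_le by metis
    then have sum: "2 * (p * f) < card S + card J + card (?o ` S) + card (?o ` J)"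
      using large cI npf by linarith
    have coll: "\<exists>T\<subseteq>K. good N g T"
      if "K \<subseteq> J" "p * f < card K + card (?o ` K)" for K
    proof -
      have gK: "g ` K \<subseteq> upper x - L"
      proof
        fix z assume "z \<in> g ` K"
        then have "z \<in> M - L" using that(1) gJ by blast
        then show "z \<in> upper x - L" using upx[of z] upper(4)[of z] by simp
      qed
      show ?thesis
        by (rule collapse[OF x up1[OF x] up2[OF x] finite_subset[OF that(1) fin(2)] gK that(2)])
    qed
    show ?thesis
    proof (cases "f \<le> card S")
      case True
      show ?thesis
      proof (cases "2 * f < card S + card (?o ` S)")
        case True
        then show ?thesis using two_blocksD[OF twoL fin(1) gS True] SI(1) by (meson order_trans)
      next
        case False
        \<comment> \<open>Since \<open>S\<close> contributes at most
          \<open>2 * f \<le> p * f\<close> to the total, \<open>J\<close> alone exceeds the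
          threshold for a collapse.\<close>
        have "2 * f \<le> p * f" using p_ge2 by simp
        then have "p * f < card J + card (?o ` J)" using sum False by linarith
        then obtain T where T: "T \<subseteq> J" "good N g T" using coll[OF order_refl] by blast
        obtain V where V: "V \<subseteq> S" "good N g V" using one_blockD[OF oneL fin(1) gS True] by blast
        have "T \<subseteq> I" "V \<subseteq> I" "T \<inter> V = {}" using T(1) V(1) SI(1,2,3) by blast+
        then show ?thesis using T(2) V(2) by (intro exI[of _ T] exI[of _ V] conjI)
      qed
    next
      case False
      \<comment> \<open>Moving exactly \<open>f - card S\<close> groups into \<open>L\<close>, keeping a term of each order outside \<open>L\<close>,
        gives one block and leaves enough terms outside \<open>L\<close> to collapse.\<close>
      define c where "c = card (?o ` J)"
      have cS: "card (?o ` S) \<le> card S" using card_image_le[OF fin(1)] .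
      obtain \<F> where \<F>: "finite \<F>" "pairwise disjnt \<F>"
          "\<And>F. F \<in> \<F> \<Longrightarrow> F \<subseteq> J \<and> card F = p \<and> (\<exists>d. \<forall>i\<in>F. ?o i = d)"
          "card J \<le> p * card \<F> + p * c" "?o ` (J - \<Union>\<F>) = ?o ` J"
        using disjoint_monochromatic_subsets_keeping_colors[OF fin(2), of p ?o] p_ge2
        unfolding c_def by auto
      obtain r where r: "f = card S + r" using False by (metis le_add_diff_inverse nat_le_linear)
      \<comment> \<open>Combines \<open>2 * c \<le> f + 1\<close> with
        \<open>(p - 1) * (f - 1) \<ge> 0\<close>.\<close>
      have pc: "c + p * c \<le> p * f + 1"
      proof -
        have "(p + 1) * (2 * c) \<le> (p + 1) * (f + 1)"
          using card_top_orders[OF gJ] unfolding c_def by (rule mult_le_mono2)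
        moreover obtain a b where "p = Suc a" "f = Suc b" using f_pos p_ge2 by (cases p; cases f) auto
        then have "p + f \<le> p * f + 1" by simp
        ultimately show ?thesis by (simp add: algebra_simps)
      qed
      have pS: "2 * card S \<le> p * card S" using p_ge2 by simp
      have pf: "p * f = p * card S + p * r" using r by (simp add: algebra_simps)
      \<comment> \<open>Indeed \<open>p * card \<F> \<ge> card J - p * c > 2 * p * f - 2 * card S -
        c - p * c \<ge> p * r - 1\<close>.\<close>
      have "p * r \<le> p * card \<F>"
        using \<F>(4) pc sum cS pS pf unfolding c_def[symmetric] by linarith
      then have "r \<le> card \<F>" using p_ge2 by simp
      then obtain \<E> where \<E>: "\<E> \<subseteq> \<F>" "card \<E> = r" "finite \<E>" by (rule obtain_subset_with_card_n)
      have "\<exists>A d. \<forall>i\<in>F. upper (g i) = A \<and> ?o i = d" if "F \<in> \<E>" for F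
      proof -
        have "F \<subseteq> J" "\<exists>d. \<forall>i\<in>F. ?o i = d" using \<F>(3)[of F] \<E>(1) that by blast+
        then show ?thesis using upx gJ by blast
      qed
      then have "g ` F \<subseteq> M - L \<and> card F = p \<and> (\<exists>A d. \<forall>i\<in>F. upper (g i) = A \<and> ?o i = d)"
        if "F \<in> \<E>" for F
        using \<F>(3)[of F] \<E>(1) that gJ by blast
      moreover have disj\<E>: "pairwise disjnt \<E>" using \<F>(2) \<E>(1) pairwise_subset by blast
      ultimately obtain K where K: "K \<subseteq> S \<union> \<Union>\<E>" "good N g K"
        using good_from_moves[OF oneL fin(1) gS \<E>(3)] r \<E>(2) by auto
      have \<E>J: "\<Union>\<E> \<subseteq> J" using \<F>(3) \<E>(1) by blast
      have "card (\<Union>\<E>) = (\<Sum>F\<in>\<E>. card F)"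
      proof (rule card_Union_disjoint[OF disj\<E>])
        fix F assume "F \<in> \<E>"
        then have "F \<subseteq> J" using \<E>J by blast
        then show "finite F" using fin(2) by (rule finite_subset)
      qed
      also have "\<dots> = (\<Sum>F\<in>\<E>. p)"
      proof (rule sum.cong[OF refl])
        fix F assume "F \<in> \<E>"
        then show "card F = p" using \<F>(3)[of F] \<E>(1) by blast
      qed
      finally have "card (\<Union>\<E>) = p * r" using \<E>(2) by simp
      then have cd: "card (J - \<Union>\<E>) = card J - p * r"
        using card_Diff_subset[OF finite_subset[OF \<E>J fin(2)] \<E>J] by simp
      \<comment> \<open>The representatives of the orders avoid all groups, in particular the chosen
        ones.\<close>
      have "J - \<Union>\<F> \<subseteq> J - \<Union>\<E>" using \<E>(1) by blast
      then have "?o ` J \<subseteq> ?o ` (J - \<Union>\<E>)" unfolding \<F>(5)[symmetric] by (rule image_mono)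
      then have "?o ` (J - \<Union>\<E>) = ?o ` J" by (rule equalityI[OF image_mono[OF Diff_subset]])
      \<comment> \<open>Here
        \<open>card J + c > 2 * p * f - 2 * card S \<ge> p * f + p * r\<close>.\<close>
      moreover have "p * f < (card J - p * r) + card (?o ` J)"
        using sum cS pS pf by linarith
      ultimately have "p * f < card (J - \<Union>\<E>) + card (?o ` (J - \<Union>\<E>))"
        by (simp only: cd)
      then obtain T where T: "T \<subseteq> J - \<Union>\<E>" "good N g T" using coll[OF Diff_subset] by blast
      have "K \<subseteq> I" "T \<subseteq> I" "K \<inter> T = {}" using K(1) T(1) SI(1,2,3) \<E>J by blast+
      then show ?thesis using T(2) K(2) by (intro exI[of _ K] exI[of _ T] conjI)
    qed
  qed
qed

end

section \<open>Induction on the index, and the case of the trivial subgroup\<close>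

context finite_comm_group
begin

text \<open>All orders are 1, so single terms are good; as at most one order occurs, the bound for
  two blocks forces two terms.\<close>

lemma one_block_trivial:
  assumes N: "subgroup N G" shows "one_block N N 1" and "two_blocks N N 1"
proof -
  have good: "good N g {i}" if "g i \<in> N" for g and i :: nat
    using that relord_eq_1_iff[OF N, of "g i"] subgroup.mem_carrier[OF N that] by (simp add: good_def)
  show "one_block N N 1"
    unfolding one_block_def
  proof (intro allI impI, elim conjE)
    fix g :: "nat \<Rightarrow> 'a" and I assume I: "finite I" "g ` I \<subseteq> N" "1 \<le> card I"
    then obtain i where "i \<in> I" by fastforce
    then show "\<exists>T\<subseteq>I. good N g T" using good[of g i] I(2) by blast
  qed
  show "two_blocks N N 1"
    unfolding two_blocks_def
  proof (intro allI impI, elim conjE)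
    fix g :: "nat \<Rightarrow> 'a" and I
    assume I: "finite I" "g ` I \<subseteq> N" and c: "2 * 1 < card I + card ((\<lambda>i. relord N (g i)) ` I)"
    have "(\<lambda>i. relord N (g i)) ` I \<subseteq> {1}"
      using relord_eq_1_iff[OF N] subgroup.mem_carrier[OF N] I(2) by blast
    then have "card ((\<lambda>i. relord N (g i)) ` I) \<le> 1" using card_mono[of "{1::nat}"] by force
    then have "2 \<le> card I" using c by simp
    then obtain i j where "i \<in> I" "j \<in> I" "i \<noteq> j"
      by (metis card_le_Suc0_iff_eq[OF I(1)] not_less_eq_eq numeral_2_eq_2)
    then show "\<exists>T\<subseteq>I. \<exists>U\<subseteq>I. T \<inter> U = {} \<and> good N g T \<and> good N g U"
      using good[of g i] good[of g j] I(2) by (intro exI[of _ "{i}"] conjI exI[of _ "{j}"]) auto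
  qed
qed

text \<open>Both subgroups vary, since the step also uses \<open>upper x\<close> over
  \<open>lower x\<close>. The statements are joined because a collapse needs
  \<open>two_blocks\<close> at the smaller index.\<close>

lemma one_and_two_blocks:
  assumes "subgroup M G" "subgroup N G" "N \<subseteq> M" "card M = n * card N"
  shows "one_block M N n \<and> two_blocks M N n"
  using assms
proof (induction n arbitrary: M N rule: less_induct)
  case (less n)
  note M = less.prems(1) and N = less.prems(2) and NM = less.prems(3) and n = less.prems(4)
  show ?case
  proof (cases "relexp N M = 1")
    case True
    have "M \<subseteq> N"
    proof
      fix x assume x: "x \<in> M"
      then have "x [^] (1::nat) \<in> N"
        using relexp_dvd_iff[OF N subgroup.subset[OF M], of 1] True by simp
      then show "x \<in> N" using subgroup.mem_carrier[OF M x] by simp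
    qed
    then have "M = N" using NM by blast
    moreover have "n = 1" using n \<open>M = N\<close> subgroup_card_pos[OF N] by simp
    ultimately show ?thesis using one_block_trivial[OF N] by simp
  next
    case False
    \<comment> \<open>Take 2 if the exponent is even; otherwise it is odd and any prime divisor
      meets the parity condition.\<close>
    obtain p where "Factorial_Ring.prime p" "p dvd relexp N M" "p = 2 \<or> odd (relexp N M)"
      using False prime_factor_nat[of "relexp N M"] two_is_prime_nat by blast
    then interpret prime_layer G M N p
      using M N NM by (intro prime_layer.intro prime_layer_axioms.intro finite_comm_group_axioms)
    have "0 < card (upper ` (M - L))"
      using L_ne_M L_M subgroup_finite[OF M] by (auto simp: card_gt_0_iff)
    then have "0 < card (upper ` (M - L)) * (p - 1)" using p_ge2 by simp
    moreover have "n = f * (1 + card (upper ` (M - L)) * (p - 1))" by (rule index_eq[OF n])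
    ultimately have "f < n" using f_pos by simp
    note IH = less.IH[OF this]
    have L: "one_block L N f" "two_blocks L N f"
      using IH[OF L N N_L card_L] by blast+
    have up: "one_block (upper x) (lower x) f" "two_blocks (upper x) (lower x) f" if "x \<in> M - L" for x
      using IH[OF upper(1) lower(1,3) card_upper_lower[OF that]] that by blast+
    have "one_block M N n" using one_block_step[OF L(1) up n] .
    then show ?thesis using two_blocks_step[OF L up n] by blast
  qed
qed

end

theorem theorem2:
  fixes G :: "('a, 'b) monoid_scheme" and g :: "nat \<Rightarrow> 'a"
  assumes "comm_group G"
    and "finite (carrier G)"
    and "g \<in> {1..order G} \<rightarrow> carrier G"
  shows "\<exists>K. K \<noteq> {} \<and> K \<subseteq> {1..order G} \<and>
           (\<Otimes>\<^bsub>G\<^esub>k\<in>K. g k) = \<one>\<^bsub>G\<^esub> \<and>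
           (\<Sum>k\<in>K. 1 / real (group.ord G (g k))) \<le> 1"
proof -
  interpret finite_comm_group G
    using assms(1,2) by (simp add: finite_comm_group_def finite_comm_group_axioms_def)
  have g: "g ` {1..order G} \<subseteq> carrier G" using assms(3) by blast
  \<comment> \<open>Over the trivial subgroup the index is the order of \<open>G\<close> and
    relative orders are the usual ones.\<close>
  have "one_block (carrier G) {\<one>\<^bsub>G\<^esub>} (order G)"
    using one_and_two_blocks[OF subgroup_self triv_subgroup, of "order G"] by (simp add: order_def)
  then obtain K where K: "K \<subseteq> {1..order G}" "good {\<one>\<^bsub>G\<^esub>} g K"
    using one_blockD[of "carrier G" "{\<one>\<^bsub>G\<^esub>}" "order G" "{1..order G}" g] g by auto
  have "(\<Sum>k\<in>K. 1 / real (ord (g k))) = (\<Sum>k\<in>K. 1 / real (relord {\<one>\<^bsub>G\<^esub>} (g k)))"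
    using K(1) g by (intro sum.cong refl) (metis image_subset_iff relord_trivial subsetD)
  then show ?thesis using K unfolding good_def by (intro exI[of _ K]) simp
qed

end
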